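(* Let $m,n$ be positive integers and let $\sigma:[m]\to[n]$ be a random function such that $\sigma(1),\ldots,\sigma(m)$ are independent (not necessarily identically distributed) random variables with values in $[n]$. For $j\in[n]$ let $B_j:=|\sigma^{-1}(j)|$. Let $d\in\{0,1,\ldots,n-1\}$, let $Q_d^{\mathrm{occ}}:=\{B_1\ge 1,\ldots,B_d\ge 1\}$, assume $Q_d^{\mathrm{occ}}$ has positive probability, and let $\nu_d^{\mathrm{occ}}$ be the law of the random set $\sigma^{-1}(n)\subseteq[m]$ conditioned on $Q_d^{\mathrm{occ}}$. Then $\nu_d^{\mathrm{occ}}$ satisfies the normalized matching property (NMP).
   Context: Notation: $[m]=\{1,\ldots,m\}$, and $2^{[m]}$ is the set of subsets of $[m]$, ordered by inclusion. A family $\mathcal{A}\subseteq 2^{[m]}$ is increasing if $S\in\mathcal{A}$ and $S\subseteq T\subseteq[m]$ imply $T\in\mathcal{A}$. A probability measure $\nu$ on $2^{[m]}$ satisfies the normalized matching property (NMP) if, with $Z$ a random subset of $[m]$ sampled according to $\nu$, $$\nu(\mathcal{A}\mid |Z|=k)\le\nu(\mathcal{A}\mid |Z|=k+1)$$ for every $k\ge 1$ and every increasing $\mathcal{A}\subseteq 2^{[m]}$, where the inequality is required only when both conditioning events $\{|Z|=k\}$ and $\{|Z|=k+1\}$ have positive probability. *)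

theory Defs
  imports "HOL-Probability.Probability"
begin

definition increasing_family :: "nat \<Rightarrow> nat set set \<Rightarrow> bool" where
  "increasing_family m \<A> \<longleftrightarrow>
     \<A> \<subseteq> Pow {1..m} \<and>
     (\<forall>S T. S \<in> \<A> \<longrightarrow> S \<subseteq> T \<longrightarrow> T \<subseteq> {1..m} \<longrightarrow> T \<in> \<A>)"

text \<open>The first two conjuncts say that \<open>\<nu>\<close> is a probability measure on the power set of
  \<open>{1..m}\<close> with the discrete sigma-algebra. The positivity premises are needed because
  \<^const>\<open>cond_prob\<close> is \<open>0\<close> when the conditioning event has probability \<open>0\<close>.\<close>

definition normalized_matching_property :: "nat \<Rightarrow> nat set measure \<Rightarrow> bool" where
  "normalized_matching_property m \<nu> \<longleftrightarrow>
     prob_space \<nu> \<and> sets \<nu> = Pow (Pow {1..m}) \<and>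
     (\<forall>k \<A>. k \<ge> 1 \<longrightarrow> increasing_family m \<A> \<longrightarrow>
        \<P>(Z in \<nu>. card Z = k) > 0 \<longrightarrow> \<P>(Z in \<nu>. card Z = k + 1) > 0 \<longrightarrow>
        \<P>(Z in \<nu>. Z \<in> \<A> \<bar> card Z = k) \<le> \<P>(Z in \<nu>. Z \<in> \<A> \<bar> card Z = k + 1))"

text \<open>A random function from \<open>{1..m}\<close> is given by its values \<open>\<sigma> i \<omega>\<close>, where \<open>i\<close> is the argument
  and \<open>\<omega>\<close> the sample point.\<close>

definition preimage_set :: "nat \<Rightarrow> (nat \<Rightarrow> 'a \<Rightarrow> nat) \<Rightarrow> nat \<Rightarrow> 'a \<Rightarrow> nat set" where
  "preimage_set m \<sigma> j \<omega> = {i \<in> {1..m}. \<sigma> i \<omega> = j}"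

definition bin_load :: "nat \<Rightarrow> (nat \<Rightarrow> 'a \<Rightarrow> nat) \<Rightarrow> nat \<Rightarrow> 'a \<Rightarrow> nat" where
  "bin_load m \<sigma> j \<omega> = card (preimage_set m \<sigma> j \<omega>)"

definition occ_event :: "'a measure \<Rightarrow> nat \<Rightarrow> (nat \<Rightarrow> 'a \<Rightarrow> nat) \<Rightarrow> nat \<Rightarrow> 'a set" where
  "occ_event M m \<sigma> d = {\<omega> \<in> space M. \<forall>j \<in> {1..d}. bin_load m \<sigma> j \<omega> \<ge> 1}"

text \<open>\<^term>\<open>uniform_measure M Q\<close> is \<open>M\<close> conditioned on the event \<open>Q\<close>.\<close>

definition occ_law :: "'a measure \<Rightarrow> nat \<Rightarrow> nat \<Rightarrow> (nat \<Rightarrow> 'a \<Rightarrow> nat) \<Rightarrow> nat \<Rightarrow> nat set measure" where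
  "occ_law M m n \<sigma> d =
     distr (uniform_measure M (occ_event M m \<sigma> d)) (count_space (Pow {1..m})) (preimage_set m \<sigma> n)"

end

theory Submission
  imports Defs
begin

text \<open>For \<open>Z \<subseteq> {1..m}\<close> let \<open>\<nu> Z\<close> be the probability that \<open>\<sigma>\<close> occupies the bins of \<open>J = {1..d}\<close> and
  that the set of balls in bin \<open>n\<close> is exactly \<open>Z\<close>. By independence \<open>\<nu> Z\<close> is a sum of products of
  the numbers \<open>w i y = P(\<sigma> i = y)\<close>, and the claim is an inequality between such sums.

  The argument of Feder and Mihail (\<open>feder_mihail_levels\<close>) reduces normalized matching to
  one-element events: it suffices that, after conditioning on \<open>X \<subseteq> Z\<close> and \<open>Y \<inter> Z = {}\<close> for any
  disjoint \<open>X\<close> and \<open>Y\<close>, each remaining ball \<open>e\<close> is at least as likely to lie in \<open>Z\<close> when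
  \<open>|Z| = k + 1\<close> as when \<open>|Z| = k\<close>. Such a conditioning only replaces some numbers \<open>w i y\<close> by zero,
  so the balls stay independent and it is enough to treat arbitrary nonnegative weights.

  Write \<open>W J k\<close> for the total weight of the functions that occupy all bins of \<open>J\<close> and send exactly
  \<open>k\<close> balls to bin \<open>n\<close>. Splitting according to the bin \<open>j\<close> that receives \<open>e\<close> when it is not in bin
  \<open>n\<close>, the one-element statement becomes
  \<open>W J (k - 1) * W (J - {j}) (k + 1) \<le> W J k * W (J - {j}) k\<close> for the balls other than \<open>e\<close>.
  This is proved by induction on the number of balls, together with the companion
  \<open>W J (k + 1) * W (J - {j}) k \<le> W J k * W (J - {j}) (k + 1)\<close>; the pair is the predicate \<open>interlaced\<close>.

  The step of the induction rests on the fact that the occupancy of a bin asks for one ball only: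
  with \<open>K = J - {j}\<close>, \<open>W J\<close> is \<open>W K\<close> minus the value of \<open>W K\<close> after the weights of bin \<open>j\<close> have been
  set to zero. Clearing these weights one ball at a time changes \<open>W K\<close> by multiples of its values on
  one ball fewer, so both inequalities reduce to two monotonicity properties of the ratios
  of consecutive values of \<open>W K\<close>: under lowering a weight (\<open>lower_weight_ratio\<close>) and under adding a
  ball (\<open>add_ball\<close>). Each of these follows from \<open>interlaced\<close> for fewer balls and the set \<open>K\<close>.

  Ratios are compared in multiplied-out form, and chaining such comparisons requires the middle terms
  to be nonzero. The induction is therefore carried out for positive weights, where the support of
  \<open>W J\<close> is known exactly, and nonnegative weights are reached as a limit.\<close>

section \<open>Total weights of occupancy configurations\<close>

text \<open>Transitivity of \<open>x / x' \<le> y / y' \<le> z / z'\<close> in multiplied-out form. The last premise is what is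
  left of the requirement that the middle denominator be nonzero.\<close>

lemma ratio_chain:
  fixes x x' y y' z z' :: real
  assumes "x * y' \<le> y * x'" "y * z' \<le> z * y'"
    and "0 \<le> x'" "0 \<le> z'" "0 \<le> z" and "y' > 0 \<or> x = 0 \<or> z' = 0"
  shows "x * z' \<le> z * x'"
proof (cases "y' > 0")
  case True
  have "(x * z') * y' = (x * y') * z'" by simp
  also have "\<dots> \<le> (y * x') * z'" using assms by (intro mult_right_mono) auto
  also have "\<dots> = (y * z') * x'" by simp
  also have "\<dots> \<le> (z * y') * x'" using assms by (intro mult_right_mono) auto
  finally have "(x * z') * y' \<le> (z * x') * y'" by (simp add: mult_ac)
  with True show ?thesis by simp
next
  case False
  then show ?thesis using assms by auto
qed

text \<open>\<open>top\<close> is the bin whose set of balls is studied. \<open>null\<close> is a bin whose occupancy is never required;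
  giving it positive weight lets any ball be placed without effect on the constraint, so that the
  support of the weights below is an interval. In the final application it has weight zero.\<close>

locale urns =
  fixes B :: "'b set" and top null :: 'b
  assumes finite_bins: "finite B" and top: "top \<in> B" and null: "null \<in> B" "null \<noteq> top"
begin

text \<open>The level \<open>k\<close> is an integer so that the recursion over balls, which passes from \<open>k\<close> to \<open>k - 1\<close>,
  needs no special case at \<open>k = 0\<close>: the weight at a negative level is zero.\<close>

definition weight :: "('a \<Rightarrow> 'b \<Rightarrow> real) \<Rightarrow> 'a set \<Rightarrow> 'b set \<Rightarrow> int \<Rightarrow> real" where
  "weight w S J k = (\<Sum>\<sigma>\<in>S \<rightarrow>\<^sub>E B.
     of_bool (J \<subseteq> \<sigma> ` S \<and> int (card {i \<in> S. \<sigma> i = top}) = k) * (\<Prod>i\<in>S. w i (\<sigma> i)))"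

lemma weight_cong:
  assumes "\<And>i y. i \<in> S \<Longrightarrow> y \<in> B \<Longrightarrow> w i y = w' i y"
  shows "weight w S J k = weight w' S J k"
  unfolding weight_def
  by (intro sum.cong arg_cong2[where f = "(*)"] prod.cong refl) (auto intro!: assms)

lemma weight_empty: "weight w {} J k = of_bool (J = {} \<and> k = 0)"
  by (auto simp: weight_def)

lemma weight_insert_all:
  assumes "finite S" "x \<notin> S"
  shows "weight w (insert x S) J k =
    (\<Sum>y\<in>B. w x y * weight w S (J - {y}) (k - of_bool (y = top)))"
proof -
  let ?c = "\<lambda>S J k \<sigma>. of_bool (J \<subseteq> \<sigma> ` S \<and> int (card {i \<in> S. \<sigma> i = top}) = k) :: real"
  have card: "int (card {i \<in> insert x S. (g(x := y)) i = top})
      = int (card {i \<in> S. g i = top}) + of_bool (y = top)" for g :: "'a \<Rightarrow> 'b" and y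
  proof -
    have "{i \<in> insert x S. (g(x := y)) i = top}
        = (if y = top then insert x {i \<in> S. g i = top} else {i \<in> S. g i = top})"
      using assms by auto
    then show ?thesis using assms by auto
  qed
  have image: "J \<subseteq> (g(x := y)) ` insert x S \<longleftrightarrow> J - {y} \<subseteq> g ` S" for g :: "'a \<Rightarrow> 'b" and y
    using assms(2) by (auto simp: image_def) 
  have "weight w (insert x S) J k = (\<Sum>(y, g)\<in>B \<times> (S \<rightarrow>\<^sub>E B).
      ?c (insert x S) J k (g(x := y)) * (\<Prod>i\<in>insert x S. w i ((g(x := y)) i)))"
    unfolding weight_def PiE_insert_eq
    by (subst sum.reindex[OF inj_combinator[OF assms(2)]]) (simp only: comp_def case_prod_unfold)
  also have "\<dots> = (\<Sum>(y, g)\<in>B \<times> (S \<rightarrow>\<^sub>E B).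
      w x y * (?c S (J - {y}) (k - of_bool (y = top)) g * (\<Prod>i\<in>S. w i (g i))))"
  proof (intro sum.cong refl, clarify)
    fix y g
    have "(\<Prod>i\<in>insert x S. w i ((g(x := y)) i)) = w x y * (\<Prod>i\<in>S. w i (g i))"
      using assms by (auto intro!: prod.cong)
    moreover have "?c (insert x S) J k (g(x := y)) = ?c S (J - {y}) (k - of_bool (y = top)) g"
      unfolding card image by (simp add: eq_diff_eq)
    ultimately show "?c (insert x S) J k (g(x := y)) * (\<Prod>i\<in>insert x S. w i ((g(x := y)) i))
        = w x y * (?c S (J - {y}) (k - of_bool (y = top)) g * (\<Prod>i\<in>S. w i (g i)))"
      by simp
  qed
  also have "\<dots> = (\<Sum>y\<in>B. w x y * weight w S (J - {y}) (k - of_bool (y = top)))"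
    by (simp add: weight_def sum.cartesian_product[symmetric] sum_distrib_left)
  finally show ?thesis .
qed

lemma weight_insert:
  assumes "finite S" "x \<notin> S" "top \<notin> J"
  shows "weight w (insert x S) J k = w x top * weight w S J (k - 1)
    + (\<Sum>y\<in>B - {top}. w x y * weight w S (J - {y}) k)"
  using assms by (simp add: weight_insert_all sum.remove[OF finite_bins top])

lemma weight_nonneg:
  assumes "\<And>i y. i \<in> S \<Longrightarrow> y \<in> B \<Longrightarrow> 0 \<le> w i y"
  shows "0 \<le> weight w S J k"
  unfolding weight_def by (intro sum_nonneg mult_nonneg_nonneg prod_nonneg) (auto intro: assms)

text \<open>The functions that occupy \<open>K\<close> but miss \<open>j\<close> are those that survive when the weights of bin \<open>j\<close>
  are set to zero. This is where it matters that the constraint on a bin is to receive at least one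
  ball, and not at least two.\<close>

lemma weight_minus_empty_bin:
  assumes "finite S" "j \<notin> K"
  shows "weight w S (insert j K) k
    = weight w S K k - weight (\<lambda>i y. if i \<in> S \<and> y = j then 0 else w i y) S K k"
  unfolding weight_def sum_subtractf[symmetric]
proof (intro sum.cong refl)
  fix \<sigma> assume "\<sigma> \<in> S \<rightarrow>\<^sub>E B"
  have "(\<Prod>i\<in>S. if i \<in> S \<and> \<sigma> i = j then 0 else w i (\<sigma> i))
      = (if j \<in> \<sigma> ` S then 0 else (\<Prod>i\<in>S. w i (\<sigma> i)))"
    using assms(1) by (auto intro!: prod.cong prod_zero)
  then show "of_bool (insert j K \<subseteq> \<sigma> ` S \<and> int (card {i \<in> S. \<sigma> i = top}) = k) * (\<Prod>i\<in>S. w i (\<sigma> i))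
    = of_bool (K \<subseteq> \<sigma> ` S \<and> int (card {i \<in> S. \<sigma> i = top}) = k) * (\<Prod>i\<in>S. w i (\<sigma> i))
      - of_bool (K \<subseteq> \<sigma> ` S \<and> int (card {i \<in> S. \<sigma> i = top}) = k)
        * (\<Prod>i\<in>S. if i \<in> S \<and> \<sigma> i = j then 0 else w i (\<sigma> i))"
    by simp
qed

text \<open>Bins outside \<open>{top, null} \<union> J\<close> may carry zero weights: the bin that is cleared in the induction
  is one of them.\<close>

definition positive :: "('a \<Rightarrow> 'b \<Rightarrow> real) \<Rightarrow> 'a set \<Rightarrow> 'b set \<Rightarrow> bool" where
  "positive w S J \<longleftrightarrow> J \<subseteq> B - {top, null} \<and>
     (\<forall>i\<in>S. (\<forall>y\<in>B. 0 \<le> w i y) \<and> (\<forall>y\<in>{top, null} \<union> J. 0 < w i y))"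

lemma positive_mono: "positive w S J \<Longrightarrow> S' \<subseteq> S \<Longrightarrow> J' \<subseteq> J \<Longrightarrow> positive w S' J'"
  unfolding positive_def by blast

lemma positive_nonneg: "positive w S J \<Longrightarrow> 0 \<le> weight w S J' k"
  by (intro weight_nonneg) (auto simp: positive_def)

text \<open>The two lemmas that follow determine the support of \<^term>\<open>weight w S J\<close>: the nonnegative
  levels that leave at least one ball for each bin of \<open>J\<close>.\<close>

lemma weight_eq_0:
  assumes "finite S" "finite J" "top \<notin> J" "k < 0 \<or> int (card S) < int (card J) + k"
  shows "weight w S J k = 0"
  using assms
proof (induction S arbitrary: J k rule: finite_induct)
  case empty
  then show ?case by (auto simp: weight_empty)
next
  case (insert x S)
  have "weight w S J (k - 1) = 0"
    using insert.prems insert.hyps by (intro insert.IH) auto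
  moreover have "weight w S (J - {y}) k = 0" for y
  proof (intro insert.IH)
    have "card J \<le> card (J - {y}) + 1"
      using card_Diff1_le[of J y] insert.prems(1) by (cases "y \<in> J") (auto simp: card_Suc_Diff1)
    with insert.prems(3) insert.hyps show "k < 0 \<or> int (card S) < int (card (J - {y})) + k"
      by auto
  qed (use insert.prems in auto)
  ultimately show ?case
    using insert.hyps insert.prems by (simp add: weight_insert)
qed

lemma weight_pos:
  assumes "finite S" "finite J" "positive w S J" "0 \<le> k" "int (card J) + k \<le> int (card S)"
  shows "0 < weight w S J k"
  using assms
proof (induction S arbitrary: J k rule: finite_induct)
  case empty
  then have "int (card J) + k \<le> 0" "0 \<le> k" by simp_all
  then have "card J = 0" "k = 0" by linarith+
  with \<open>finite J\<close> have "J = {}" by simp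
  with \<open>k = 0\<close> show ?case by (simp add: weight_empty)
next
  case (insert x S)
  have J: "top \<notin> J" "null \<notin> J" "J \<subseteq> B" and w: "\<And>y. y \<in> B \<Longrightarrow> 0 \<le> w x y" "0 < w x top" "0 < w x null"
      "\<And>y. y \<in> J \<Longrightarrow> 0 < w x y"
    using insert.prems unfolding positive_def by auto
  have nn: "0 \<le> weight w S J' k'" for J' k'
    using positive_mono[OF insert.prems(2), of S J] by (auto intro: positive_nonneg)
  have pos: "positive w S J'" if "J' \<subseteq> J" for J'
    using positive_mono[OF insert.prems(2)] that by auto
  have rest: "0 \<le> w x y * weight w S (J - {y}) k" if "y \<in> B - {top}" for y
    using that w nn by simp
  have fst: "0 \<le> w x top * weight w S J (k - 1)" using w nn by (simp add: less_imp_le)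
  show ?case
  proof (cases "k \<ge> 1")
    case True
    then have "0 < weight w S J (k - 1)"
      using insert.prems insert.hyps pos by (intro insert.IH) auto
    with w have "0 < w x top * weight w S J (k - 1)" by simp
    moreover have "0 \<le> (\<Sum>y\<in>B - {top}. w x y * weight w S (J - {y}) k)"
      using rest by (intro sum_nonneg)
    ultimately show ?thesis using insert.hyps J by (simp add: weight_insert)
  next
    case False
    obtain y where y: "y \<in> B - {top}" "0 < w x y" "int (card (J - {y})) + k \<le> int (card S)"
    proof (cases "J = {}")
      case True
      then show ?thesis using that[of null] null w False insert.prems by auto
    next
      case False
      then obtain y where "y \<in> J" by auto
      then have "int (card (J - {y})) + k \<le> int (card S)"
        using card_Suc_Diff1[of J y] insert.prems(1,4) insert.hyps by auto
      with \<open>y \<in> J\<close> show ?thesis using that[of y] J w by blast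
    qed
    have "0 < weight w S (J - {y}) k"
      using insert.prems insert.hyps pos y by (intro insert.IH) auto
    with y have "0 < (\<Sum>y\<in>B - {top}. w x y * weight w S (J - {y}) k)"
      using rest finite_bins by (intro sum_pos2[of _ y]) auto
    with fst show ?thesis using insert.hyps J by (simp add: weight_insert)
  qed
qed


section \<open>Interlacing of the weights for nested constraints\<close>

text \<open>With \<open>r J k = W J k / W J (k + 1)\<close> the two conditions say that
  \<open>r J (k - 1) \<le> r (J - {j}) k\<close> and \<open>r (J - {j}) k \<le> r J k\<close>: the ratio sequences of \<open>J\<close> and
  \<open>J - {j}\<close> interlace. For \<open>j \<notin> J\<close> the first condition is log-concavity of the weight
  in \<open>k\<close> and the second is an equality.\<close>

definition interlaced :: "('a \<Rightarrow> 'b \<Rightarrow> real) \<Rightarrow> 'a set \<Rightarrow> 'b set \<Rightarrow> bool" where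
  "interlaced w S J \<longleftrightarrow> (\<forall>j\<in>B - {top}. \<forall>k.
     weight w S J (k - 1) * weight w S (J - {j}) (k + 1) \<le> weight w S J k * weight w S (J - {j}) k \<and>
     weight w S J (k + 1) * weight w S (J - {j}) k \<le> weight w S J k * weight w S (J - {j}) (k + 1))"

lemma interlaced_shift:
  assumes "interlaced w S J" "j \<in> B - {top}"
  shows "weight w S J (k - 1) * weight w S (J - {j}) (k + 1) \<le> weight w S J k * weight w S (J - {j}) k"
  using assms unfolding interlaced_def by blast

lemma interlaced_same:
  assumes "interlaced w S J" "j \<in> B - {top}"
  shows "weight w S J (k + 1) * weight w S (J - {j}) k \<le> weight w S J k * weight w S (J - {j}) (k + 1)"
  using assms unfolding interlaced_def by blast

lemma interlaced_log_concave:
  assumes "interlaced w S J" "null \<notin> J"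
  shows "weight w S J (k - 1) * weight w S J (k + 1) \<le> weight w S J k * weight w S J k"
  using interlaced_shift[OF assms(1), of null k] assms(2) null by simp

text \<open>Expanding the weights of \<^term>\<open>insert x S\<close> by the bin of \<open>x\<close>, the terms with \<open>x\<close> in \<open>top\<close> cancel,
  and the term for each other bin \<open>y\<close> is the first interlacing condition for \<open>J\<close> and \<open>J - {y}\<close>. The
  levels \<open>k - 1\<close>, \<open>k\<close> on \<open>S\<close> are compared with \<open>k\<close>, \<open>k + 1\<close> on \<^term>\<open>insert x S\<close>, so that
  the numbers of balls outside \<open>top\<close> agree.\<close>

lemma add_ball:
  assumes "finite S" "x \<notin> S" "top \<notin> J" "interlaced w S J" "\<And>y. y \<in> B \<Longrightarrow> 0 \<le> w x y"
  shows "weight w S J (k - 1) * weight w (insert x S) J (k + 1)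
    \<le> weight w (insert x S) J k * weight w S J k"
proof -
  have "(\<Sum>y\<in>B - {top}. w x y * (weight w S J (k - 1) * weight w S (J - {y}) (k + 1)))
      \<le> (\<Sum>y\<in>B - {top}. w x y * (weight w S J k * weight w S (J - {y}) k))"
    using assms(5) by (intro sum_mono mult_left_mono interlaced_shift[OF assms(4)]) auto
  then show ?thesis
    by (simp add: weight_insert[OF assms(1-3)] algebra_simps sum_distrib_left)
qed

text \<open>If the occupancy of \<open>h\<close> is not required, putting \<open>x\<close> into \<open>h\<close> leaves the constraint \<open>J\<close> to the
  other balls unchanged, so the weight is affine in \<open>w x h\<close> with slope \<^term>\<open>weight w S J k\<close>.\<close>

lemma lower_weight:
  assumes "finite S" "x \<notin> S" "top \<notin> J" "h \<in> B - {top}" "h \<notin> J"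
    and w': "\<And>i y. i \<in> S \<Longrightarrow> w' i y = w i y" "\<And>y. y \<noteq> h \<Longrightarrow> w' x y = w x y"
  shows "weight w (insert x S) J k = weight w' (insert x S) J k + (w x h - w' x h) * weight w S J k"
proof -
  have same: "weight w' S J' k' = weight w S J' k'" for J' k'
    using w'(1) by (intro weight_cong)
  have top': "w' x top = w x top" using assms(4) w'(2) by auto
  have rest: "(\<Sum>y\<in>B - {top} - {h}. w' x y * weight w S (J - {y}) k)
      = (\<Sum>y\<in>B - {top} - {h}. w x y * weight w S (J - {y}) k)"
    using w'(2) by (intro sum.cong) auto
  show ?thesis
    using finite_bins assms(4,5)
    by (simp add: weight_insert[OF assms(1-3)] same top' sum.remove[of "B - {top}" h] rest algebra_simps)
qed

text \<open>After cancelling the common part of both sides (\<open>lower_weight\<close>) and expanding by the bin of \<open>x\<close>, the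
  term for \<open>top\<close> is log-concavity on \<open>S\<close>, and the term for each other bin is the second interlacing
  condition on \<open>S\<close>.\<close>

lemma lower_weight_ratio:
  assumes S: "finite S" "x \<notin> S" and J: "top \<notin> J" "null \<notin> J" and h: "h \<in> B - {top}" "h \<notin> J"
    and w': "\<And>i y. i \<in> S \<Longrightarrow> w' i y = w i y" "\<And>y. y \<noteq> h \<Longrightarrow> w' x y = w x y"
    and nonneg: "\<And>y. y \<in> B \<Longrightarrow> 0 \<le> w' x y" and le: "w' x h \<le> w x h"
    and IH: "interlaced w S J"
  shows "weight w' (insert x S) J k * weight w (insert x S) J (k + 1)
    \<le> weight w (insert x S) J k * weight w' (insert x S) J (k + 1)"
proof -
  have same: "weight w' S J' k' = weight w S J' k'" for J' k'
    using w'(1) by (intro weight_cong)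
  have "(\<Sum>y\<in>B - {top}. w' x y * (weight w S J (k + 1) * weight w S (J - {y}) k))
      \<le> (\<Sum>y\<in>B - {top}. w' x y * (weight w S J k * weight w S (J - {y}) (k + 1)))"
    using nonneg by (intro sum_mono mult_left_mono interlaced_same[OF IH]) auto
  moreover have "w' x top * (weight w S J (k - 1) * weight w S J (k + 1))
      \<le> w' x top * (weight w S J k * weight w S J k)"
    using nonneg top by (intro mult_left_mono interlaced_log_concave IH J)
  ultimately have "weight w' (insert x S) J k * weight w S J (k + 1)
      \<le> weight w S J k * weight w' (insert x S) J (k + 1)"
    by (simp add: weight_insert[OF S J(1)] same algebra_simps sum_distrib_left)
  then have "(w x h - w' x h) * (weight w' (insert x S) J k * weight w S J (k + 1))
      \<le> (w x h - w' x h) * (weight w S J k * weight w' (insert x S) J (k + 1))"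
    using le by (intro mult_left_mono) auto
  moreover have diff: "weight w (insert x S) J k'
      = weight w' (insert x S) J k' + (w x h - w' x h) * weight w S J k'" for k'
    by (rule lower_weight[OF S J(1) h]) (use w' in auto)
  ultimately show ?thesis unfolding diff by (simp add: algebra_simps)
qed

text \<open>The two inequalities that become the interlacing conditions for \<^term>\<open>insert j J\<close> and \<open>J\<close> when \<open>T\<close> is
  the whole of \<open>S\<close>. They are proved by adding balls to \<open>T\<close> one at a time. The first one is a chain
  of applications of \<open>lower_weight_ratio\<close>. In the second one each new ball \<open>x\<close> adds a multiple of the
  weight on the other balls to the left-hand side and to the right-hand side; these are
  compared by \<open>add_ball\<close> followed by the first inequality.\<close>

lemma empty_bin_ratios:
  fixes w :: "'a \<Rightarrow> 'b \<Rightarrow> real" and j :: 'b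
  defines "cleared \<equiv> \<lambda>T i y. if i \<in> T \<and> y = j then 0 else w i y"
  assumes S: "finite S" and pos: "positive w S J" and j: "j \<in> B - {top, null}" "j \<notin> J"
    and IH: "\<And>x w'. x \<in> S \<Longrightarrow> positive w' (S - {x}) J \<Longrightarrow> interlaced w' (S - {x}) J"
    and T: "T \<subseteq> S"
  shows "weight (cleared T) S J k * weight w S J (k + 1) \<le> weight w S J k * weight (cleared T) S J (k + 1)"
    and "(weight w S J (k - 1) - weight (cleared T) S J (k - 1)) * weight w S J (k + 1)
      \<le> (weight w S J k - weight (cleared T) S J k) * weight w S J k"
proof -
  let ?W = "weight w S J"
  have J: "top \<notin> J" "null \<notin> J" "finite J"
    using pos finite_bins unfolding positive_def by (auto intro: finite_subset)
  have pos_cleared: "positive (cleared T) S J" for T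
    using pos j unfolding positive_def cleared_def by auto
  have W: "0 \<le> ?W k" for k using pos by (rule positive_nonneg)
  have "finite T" using S T by (rule rev_finite_subset)
  then have "T \<subseteq> S \<Longrightarrow> (\<forall>k. weight (cleared T) S J k * ?W (k + 1) \<le> ?W k * weight (cleared T) S J (k + 1))
     \<and> (\<forall>k. (?W (k - 1) - weight (cleared T) S J (k - 1)) * ?W (k + 1)
          \<le> (?W k - weight (cleared T) S J k) * ?W k)"
  proof (induction T rule: finite_induct)
    case empty
    have "cleared {} = w" by (simp add: cleared_def fun_eq_iff)
    then show ?case by simp
  next
    case (insert x T)
    define S' where "S' = S - {x}"
    have S': "finite S'" "x \<notin> S'" "S = insert x S'" using S insert.prems by (auto simp: S'_def)
    let ?U = "weight (cleared T) S J" and ?V = "weight (cleared (insert x T)) S J"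
    let ?g = "weight (cleared T) S' J"
    have U: "0 \<le> ?U k" and V: "0 \<le> ?V k" and g: "0 \<le> ?g k" for k
      using positive_nonneg[OF pos_cleared] positive_nonneg[OF positive_mono[OF pos_cleared, where S' = S' and J' = J]]
      by (auto simp: S'(3) subset_insertI)
    have pU: "?U (k + 1) > 0 \<or> ?W (k + 1) = 0" for k
      using weight_pos[OF S J(3) pos_cleared, of "k + 1" T] weight_eq_0[OF S J(3,1), of "k + 1" w]
      by linarith
    have int: "interlaced (cleared T) S' J"
      unfolding S'_def using insert.prems positive_mono[OF pos_cleared] by (intro IH) auto
    have nonneg: "0 \<le> cleared T' x y" if "y \<in> B" for T' y
      using pos_cleared[of T'] that insert.prems unfolding positive_def by auto
    have UW: "?U k * ?W (k + 1) \<le> ?W k * ?U (k + 1)" for k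
      using insert by auto
    have diff: "?U k = ?V k + w x j * ?g k" for k
    proof -
      have "?U k = ?V k + (cleared T x j - cleared (insert x T) x j) * ?g k"
        unfolding S'(3)
        by (rule lower_weight[OF S'(1,2) J(1) _ j(2)]) (use j S'(2) in \<open>auto simp: cleared_def\<close>)
      then show ?thesis using insert.hyps by (simp add: cleared_def)
    qed
    have VU: "?V k * ?U (k + 1) \<le> ?U k * ?V (k + 1)" for k
      unfolding S'(3)
      by (rule lower_weight_ratio[OF S'(1,2) J(1,2) _ j(2) _ _ _ _ int])
        (use j S'(2) nonneg[of _ "{}"] in \<open>auto simp: cleared_def\<close>)
    have gU: "?g (k - 1) * ?U (k + 1) \<le> ?U k * ?g k" for k
      unfolding S'(3) by (rule add_ball[OF S'(1,2) J(1) int nonneg])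
    have "?V k * ?W (k + 1) \<le> ?W k * ?V (k + 1)" for k
      by (rule ratio_chain[OF VU UW]) (use U V W pU[of k] in auto)
    moreover have "(?W (k - 1) - ?V (k - 1)) * ?W (k + 1) \<le> (?W k - ?V k) * ?W k" for k
    proof -
      \<comment> \<open>From the other balls with weights \<open>cleared T\<close> to all balls with weights \<open>cleared T\<close>, and from
         there to all balls with weights \<open>w\<close>.\<close>
      have "?g (k - 1) * ?W (k + 1) \<le> ?W k * ?g k"
        by (rule ratio_chain[OF gU UW]) (use U g W pU[of k] in auto)
      then have "w x j * (?g (k - 1) * ?W (k + 1)) \<le> w x j * (?W k * ?g k)"
        using nonneg[of j "{}"] j by (intro mult_left_mono) (auto simp: cleared_def)
      moreover have "(?W (k - 1) - ?U (k - 1)) * ?W (k + 1) \<le> (?W k - ?U k) * ?W k"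
        using insert by auto
      ultimately show ?thesis
        unfolding diff by (simp add: algebra_simps)
    qed
    ultimately show ?case by blast
  qed
  with T show "weight (cleared T) S J k * weight w S J (k + 1) \<le> weight w S J k * weight (cleared T) S J (k + 1)"
    and "(weight w S J (k - 1) - weight (cleared T) S J (k - 1)) * weight w S J (k + 1)
      \<le> (weight w S J k - weight (cleared T) S J k) * weight w S J k"
    by auto
qed

text \<open>Without a constraint the weights are the coefficients of the product of the linear polynomials
  \<open>w x top * t + r x\<close>, where \<open>r x\<close> is the total weight of \<open>x\<close> outside \<open>top\<close>. Multiplication by such a
  factor preserves log-concavity of nonnegative sequences without internal zeros.\<close>

lemma log_concave_no_constraint:
  assumes "finite S" "positive w S {}"
  shows "weight w S {} (k - 1) * weight w S {} (k + 1) \<le> weight w S {} k * weight w S {} k"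
  using assms
proof (induction S arbitrary: k rule: finite_induct)
  case empty
  then show ?case by (auto simp: weight_empty)
next
  case (insert x S)
  let ?g = "weight w S {}"
  have pos: "positive w S {}" using insert.prems by (rule positive_mono) auto
  have g: "0 \<le> ?g k" for k using pos by (rule positive_nonneg)
  have LC: "?g (k - 1) * ?g (k + 1) \<le> ?g k * ?g k" for k using insert.IH pos .
  define a r where "a = w x top" and "r = (\<Sum>y\<in>B - {top}. w x y)"
  have ar: "0 \<le> a" "0 \<le> r"
    using insert.prems top unfolding a_def r_def positive_def by (auto intro!: sum_nonneg)
  have G: "weight w (insert x S) {} k = a * ?g (k - 1) + r * ?g k" for k
    using insert.hyps by (simp add: weight_insert a_def r_def sum_distrib_right)
  have cross: "?g (k - 2) * ?g (k + 1) \<le> ?g k * ?g (k - 1)"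
  proof (rule ratio_chain)
    show "?g (k - 2) * ?g k \<le> ?g (k - 1) * ?g (k - 1)" using LC[of "k - 1"] by simp
    show "?g (k - 1) * ?g (k + 1) \<le> ?g k * ?g k" using LC[of k] by simp
    show "0 < ?g k \<or> ?g (k - 2) = 0 \<or> ?g (k + 1) = 0"
      using weight_pos[OF insert.hyps(1) _ pos, of k] weight_eq_0[OF insert.hyps(1), of "{}" "k + 1" w]
        weight_eq_0[OF insert.hyps(1), of "{}" "k - 2" w]
      by fastforce
  qed (use g in auto)
  have "a * a * (?g (k - 2) * ?g k) \<le> a * a * (?g (k - 1) * ?g (k - 1))"
    using LC[of "k - 1"] ar by (intro mult_left_mono) auto
  moreover have "r * r * (?g (k - 1) * ?g (k + 1)) \<le> r * r * (?g k * ?g k)"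
    using LC[of k] ar by (intro mult_left_mono) auto
  moreover have "a * r * (?g (k - 2) * ?g (k + 1)) \<le> a * r * (?g k * ?g (k - 1))"
    using cross ar by (intro mult_left_mono) auto
  ultimately show ?case by (simp add: G algebra_simps)
qed

text \<open>For \<open>j \<in> J\<close> both conditions come from \<open>empty_bin_ratios\<close> for \<open>J - {j}\<close> with every ball cleared.
  For \<open>j \<notin> J\<close> log-concavity is needed; if \<open>J\<close> contains some \<open>j'\<close>, it follows by combining the two
  conditions for \<open>j'\<close>, because \<open>r J (k - 1) \<le> r (J - {j'}) k \<le> r J k\<close>.\<close>

lemma interlaced_positive:
  assumes "finite S" "positive w S J"
  shows "interlaced w S J"
  using assms
proof (induction "card S" arbitrary: S w J rule: less_induct)
  case less
  note S = less.prems(1) and pos = less.prems(2)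
  let ?A = "weight w S J"
  have J: "J \<subseteq> B - {top, null}" "finite J"
    using pos finite_bins unfolding positive_def by (auto intro: finite_subset)
  have A: "0 \<le> ?A k" for k using pos by (rule positive_nonneg)
  have constrained: "?A (k - 1) * weight w S (J - {j}) (k + 1) \<le> ?A k * weight w S (J - {j}) k"
    "?A (k + 1) * weight w S (J - {j}) k \<le> ?A k * weight w S (J - {j}) (k + 1)" if "j \<in> J" for j k
  proof -
    let ?K = "J - {j}"
    let ?cleared = "\<lambda>i y. if i \<in> S \<and> y = j then 0 else w i y"
    have posK: "positive w S ?K" using pos by (rule positive_mono) auto
    have j: "j \<in> B - {top, null}" "j \<notin> ?K" using that J by auto
    have IH: "interlaced w' (S - {x}) ?K" if "x \<in> S" "positive w' (S - {x}) ?K" for x w'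
      using that S by (intro less.hyps card_Diff1_less) auto
    have diff: "?A k = weight w S ?K k - weight ?cleared S ?K k" for k
      using weight_minus_empty_bin[OF S j(2), of w k] that by (simp add: insert_absorb)
    show "?A (k - 1) * weight w S ?K (k + 1) \<le> ?A k * weight w S ?K k"
      "?A (k + 1) * weight w S ?K k \<le> ?A k * weight w S ?K (k + 1)"
      using empty_bin_ratios[OF S posK j IH subset_refl, of k]
      unfolding diff by (simp_all add: algebra_simps)
  qed
  have log_concave: "?A (k - 1) * ?A (k + 1) \<le> ?A k * ?A k" for k
  proof (cases "J = {}")
    case True
    then show ?thesis using log_concave_no_constraint[OF S] pos by simp
  next
    case False
    then obtain j where j: "j \<in> J" by auto
    let ?K = "J - {j}"
    have posK: "positive w S ?K" using pos by (rule positive_mono) auto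
    have "Suc (card ?K) = card J" using J j by (intro card_Suc_Diff1)
    then have mid: "0 < weight w S ?K (k + 1) \<or> ?A (k - 1) = 0 \<or> ?A (k + 1) = 0"
      using weight_pos[OF S _ posK, of "k + 1"] weight_eq_0[OF S J(2), of "k + 1" w] J by fastforce
    have "?A (k - 1) * weight w S ?K (k + 1) \<le> weight w S ?K k * ?A k"
      and "weight w S ?K k * ?A (k + 1) \<le> ?A k * weight w S ?K (k + 1)"
      using constrained[OF j, of k] by (simp_all add: mult.commute)
    then show ?thesis by (rule ratio_chain) (use A mid in auto)
  qed
  show ?case
    unfolding interlaced_def
  proof (intro ballI allI)
    fix j k assume "j \<in> B - {top}"
    show "?A (k - 1) * weight w S (J - {j}) (k + 1) \<le> ?A k * weight w S (J - {j}) k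
      \<and> ?A (k + 1) * weight w S (J - {j}) k \<le> ?A k * weight w S (J - {j}) (k + 1)"
      using constrained[of j k] log_concave[of k] by (cases "j \<in> J") (auto simp: mult.commute)
  qed
qed

lemma interlaced_nonneg:
  assumes "finite S" "J \<subseteq> B - {top, null}" "\<And>i y. i \<in> S \<Longrightarrow> y \<in> B \<Longrightarrow> 0 \<le> w i y"
  shows "interlaced w S J"
proof -
  define w' where "w' e i y = w i y + e" for e i y
  have lim: "((\<lambda>e. weight (w' e) S J' k) \<longlongrightarrow> weight w S J' k) (at_right 0)" for J' k
  proof -
    have "((\<lambda>e. weight (w' e) S J' k) \<longlongrightarrow> weight (w' 0) S J' k) (at_right 0)"
      unfolding weight_def w'_def by (intro tendsto_intros)
    moreover have "w' 0 = w" by (simp add: w'_def fun_eq_iff)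
    ultimately show ?thesis by simp
  qed
  have int: "interlaced (w' e) S J" if "e > 0" for e
    using assms that
    by (intro interlaced_positive) (auto simp: positive_def w'_def top null subset_iff intro!: add_nonneg_pos)
  have ev: "eventually (\<lambda>e. interlaced (w' e) S J) (at_right 0)"
    using eventually_at_right_less[of "0::real"] by (rule eventually_mono) (rule int)
  show ?thesis
    unfolding interlaced_def
  proof (intro ballI allI conjI)
    fix j k assume j: "j \<in> B - {top}"
    show "weight w S J (k - 1) * weight w S (J - {j}) (k + 1) \<le> weight w S J k * weight w S (J - {j}) k"
      by (rule tendsto_le[of "at_right 0", OF _ tendsto_mult[OF lim lim] tendsto_mult[OF lim lim]])
        (auto intro: eventually_mono[OF ev] interlaced_shift[OF _ j])
    show "weight w S J (k + 1) * weight w S (J - {j}) k \<le> weight w S J k * weight w S (J - {j}) (k + 1)"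
      by (rule tendsto_le[of "at_right 0", OF _ tendsto_mult[OF lim lim] tendsto_mult[OF lim lim]])
        (auto intro: eventually_mono[OF ev] interlaced_same[OF _ j])
  qed
qed

end

section \<open>From single elements to increasing families\<close>

definition level_mass :: "('a set \<Rightarrow> real) \<Rightarrow> 'a set \<Rightarrow> 'a set \<Rightarrow> 'a set \<Rightarrow> nat \<Rightarrow> 'a set set \<Rightarrow> real" where
  "level_mass \<nu> S X Y k \<A> = (\<Sum>Z | X \<subseteq> Z \<and> Z \<subseteq> S - Y \<and> card Z = k \<and> Z \<in> \<A>. \<nu> Z)"

text \<open>A family has conditional probability \<open>pA / p\<close> if a given element is present and \<open>qA / q\<close> if it is
  absent; primes refer to the higher level. Passing to the higher level raises both conditional
  probabilities and also the probability that the element is present. As presence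
  favours the family at the higher level (the fourth premise), the total probability of the family
  increases.\<close>

lemma mixture_ratio_mono:
  fixes p q p' q' pA qA pA' qA' :: real
  assumes "pA * p' \<le> pA' * p" "qA * q' \<le> qA' * q" "p * q' \<le> p' * q" "qA' * p' \<le> pA' * q'"
    and "0 < p'" "0 < q'"
  shows "(pA + qA) * (p' + q') \<le> (pA' + qA') * (p + q)"
proof -
  have "(pA * q' + qA * p') * (p' * q') = (pA * p') * (q' * q') + (qA * q') * (p' * p')"
    by (simp add: algebra_simps)
  also have "\<dots> \<le> (pA' * p) * (q' * q') + (qA' * q) * (p' * p')"
    using assms by (intro add_mono mult_right_mono) auto
  also have "\<dots> \<le> (pA' * q + qA' * p) * (p' * q')"
  proof -
    have "0 \<le> (pA' * q' - qA' * p') * (p' * q - p * q')" using assms by simp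
    then show ?thesis by (simp add: algebra_simps)
  qed
  finally have "pA * q' + qA * p' \<le> pA' * q + qA' * p"
    using assms by (simp add: mult_le_cancel_right)
  with assms(1,2) show ?thesis by (simp add: algebra_simps)
qed

lemma level_mass_nonneg: "(\<And>Z. Z \<subseteq> S \<Longrightarrow> 0 \<le> \<nu> Z) \<Longrightarrow> 0 \<le> level_mass \<nu> S X Y k \<A>"
  unfolding level_mass_def by (intro sum_nonneg) auto

lemma level_mass_mono:
  assumes "finite S" "\<And>Z. Z \<subseteq> S \<Longrightarrow> 0 \<le> \<nu> Z" "\<A> \<subseteq> \<B>"
  shows "level_mass \<nu> S X Y k \<A> \<le> level_mass \<nu> S X Y k \<B>"
  unfolding level_mass_def
  by (intro sum_mono2) (use assms in \<open>auto intro: finite_subset[of _ "Pow S"]\<close>)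

lemma level_mass_split:
  assumes "finite S" "e \<in> S - X - Y"
  shows "level_mass \<nu> S X Y k \<A> = level_mass \<nu> S (insert e X) Y k \<A> + level_mass \<nu> S X (insert e Y) k \<A>"
  unfolding level_mass_def
  by (subst sum.union_disjoint[symmetric])
    (use assms in \<open>auto intro: finite_subset[of _ "Pow S"] intro!: sum.cong\<close>)

lemma level_mass_pos:
  assumes "finite S" "\<And>Z. Z \<subseteq> S \<Longrightarrow> 0 \<le> \<nu> Z"
    and "X \<subseteq> Z" "Z \<subseteq> S - Y" "card Z = k" "Z \<in> \<A>" "0 < \<nu> Z"
  shows "0 < level_mass \<nu> S X Y k \<A>"
  unfolding level_mass_def
  by (rule sum_pos2[of _ Z]) (use assms(1,3-) in \<open>auto intro: finite_subset[of _ "Pow S"] intro!: assms(2)\<close>)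

text \<open>Double counting: each set of the level contains \<open>k - card X\<close> elements outside \<open>X\<close>.\<close>

lemma sum_level_mass_insert:
  assumes S: "finite S" and XY: "X \<subseteq> S" "X \<inter> Y = {}"
  shows "(\<Sum>e\<in>S - X - Y. level_mass \<nu> S (insert e X) Y k \<A>)
    = (real k - real (card X)) * level_mass \<nu> S X Y k \<A>"
proof -
  let ?L = "{Z. X \<subseteq> Z \<and> Z \<subseteq> S - Y \<and> card Z = k \<and> Z \<in> \<A>}"
  have L: "finite ?L" using S by (auto intro: finite_subset[of _ "Pow S"])
  have "level_mass \<nu> S (insert e X) Y k \<A> = (\<Sum>Z\<in>?L. of_bool (e \<in> Z) * \<nu> Z)" for e
  proof -
    have "{Z. insert e X \<subseteq> Z \<and> Z \<subseteq> S - Y \<and> card Z = k \<and> Z \<in> \<A>} = ?L \<inter> {Z. e \<in> Z}" by auto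
    then show ?thesis
      using L by (simp add: level_mass_def sum.inter_restrict of_bool_def if_distrib[of "\<lambda>x. x * _"] cong: if_cong)
  qed
  then have "(\<Sum>e\<in>S - X - Y. level_mass \<nu> S (insert e X) Y k \<A>)
      = (\<Sum>Z\<in>?L. \<Sum>e\<in>S - X - Y. of_bool (e \<in> Z) * \<nu> Z)"
    by (simp add: sum.swap[of _ ?L])
  also have "\<dots> = (\<Sum>Z\<in>?L. (real k - real (card X)) * \<nu> Z)"
  proof (intro sum.cong refl)
    fix Z assume Z: "Z \<in> ?L"
    then have fin: "finite Z" using S by (auto intro: finite_subset)
    have "(S - X - Y) \<inter> Z = Z - X" using Z by auto
    then have "(\<Sum>e\<in>S - X - Y. of_bool (e \<in> Z) :: real) = real (card (Z - X))"
      using S by (simp add: Int_def)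
    also have "\<dots> = real k - real (card X)"
      using Z fin card_mono[of Z X] by (auto simp: card_Diff_subset finite_subset of_nat_diff)
    finally show "(\<Sum>e\<in>S - X - Y. of_bool (e \<in> Z) * \<nu> Z) = (real k - real (card X)) * \<nu> Z"
      by (simp add: sum_distrib_right[symmetric])
  qed
  finally show ?thesis by (simp add: level_mass_def sum_distrib_left)
qed

text \<open>Induction on the number of undecided elements, by conditioning on whether an element \<open>e\<close> belongs to
  \<open>Z\<close>. The choice of \<open>e\<close> matters: \<open>mixture_ratio_mono\<close> needs \<open>\<A>\<close> and \<open>e \<in> Z\<close> to be
  nonnegatively correlated at level \<open>k + 1\<close>. Such an \<open>e\<close> exists because \<open>card Z\<close> is constant on the level,
  so the covariances of \<open>\<A>\<close> with the events \<open>e \<in> Z\<close> add up to zero.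

  The conditional probabilities at level \<open>k + 1\<close> make sense only if \<open>e \<in> Z\<close> is neither certain nor
  impossible there. If no element qualifies, \<open>single\<close> implies that each set of positive mass at level \<open>k\<close> is
  contained in each one at level \<open>k + 1\<close>, and the claim holds since \<open>\<A>\<close> is increasing.\<close>

lemma feder_mihail_levels:
  fixes \<nu> :: "'a set \<Rightarrow> real"
  assumes S: "finite S" and nonneg: "\<And>Z. Z \<subseteq> S \<Longrightarrow> 0 \<le> \<nu> Z"
    and up: "\<And>Z Z'. Z \<in> \<A> \<Longrightarrow> Z \<subseteq> Z' \<Longrightarrow> Z' \<subseteq> S \<Longrightarrow> Z' \<in> \<A>"
    and single: "\<And>X Y e k. X \<subseteq> S \<Longrightarrow> Y \<subseteq> S \<Longrightarrow> X \<inter> Y = {} \<Longrightarrow> e \<in> S - X - Y \<Longrightarrow>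
      level_mass \<nu> S (insert e X) Y k UNIV * level_mass \<nu> S X (insert e Y) (k + 1) UNIV
      \<le> level_mass \<nu> S (insert e X) Y (k + 1) UNIV * level_mass \<nu> S X (insert e Y) k UNIV"
    and XY: "X \<subseteq> S" "Y \<subseteq> S" "X \<inter> Y = {}"
  shows "level_mass \<nu> S X Y k \<A> * level_mass \<nu> S X Y (k + 1) UNIV
    \<le> level_mass \<nu> S X Y (k + 1) \<A> * level_mass \<nu> S X Y k UNIV"
  using XY
proof (induction "card (S - X - Y)" arbitrary: X Y rule: less_induct)
  case less
  note XY = less.prems
  define F where "F = S - X - Y"
  define M where "M k \<B> = level_mass \<nu> S X Y k \<B>" for k \<B>
  define M1 where "M1 e k \<B> = level_mass \<nu> S (insert e X) Y k \<B>" for e k \<B>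
  define M0 where "M0 e k \<B> = level_mass \<nu> S X (insert e Y) k \<B>" for e k \<B>
  note defs = M_def M1_def M0_def
  have nn: "0 \<le> M k \<B>" "0 \<le> M1 e k \<B>" "0 \<le> M0 e k \<B>" for e k \<B>
    unfolding defs by (simp_all add: level_mass_nonneg nonneg)
  have le: "M k \<B> \<le> M k UNIV" "M1 e k \<B> \<le> M1 e k UNIV" "M0 e k \<B> \<le> M0 e k UNIV" for e k \<B>
    unfolding defs by (simp_all add: level_mass_mono S nonneg)
  have split: "M k \<B> = M1 e k \<B> + M0 e k \<B>" if "e \<in> F" for e k \<B>
    using level_mass_split[OF S] that unfolding defs F_def by blast
  have single': "M1 e k UNIV * M0 e (k + 1) UNIV \<le> M1 e (k + 1) UNIV * M0 e k UNIV" if "e \<in> F" for e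
    using single[OF XY] that unfolding defs F_def by blast
  \<comment> \<open>The covariance of \<open>\<A>\<close> and \<open>e \<in> Z\<close> at level \<open>k + 1\<close>, up to the square of the total mass.\<close>
  define cov where "cov e = M1 e (k + 1) \<A> * M0 e (k + 1) UNIV - M0 e (k + 1) \<A> * M1 e (k + 1) UNIV" for e
  have cov: "cov e = M1 e (k + 1) \<A> * M (k + 1) UNIV - M (k + 1) \<A> * M1 e (k + 1) UNIV" if "e \<in> F" for e
    unfolding cov_def split[OF that] by (simp add: algebra_simps)
  have sum_M1: "(\<Sum>e\<in>F. M1 e (k + 1) \<B>) = (real (k + 1) - real (card X)) * M (k + 1) \<B>" for \<B>
    unfolding F_def defs using sum_level_mass_insert[OF S XY(1,3)] .
  have "(\<Sum>e\<in>F. cov e) = (\<Sum>e\<in>F. M1 e (k + 1) \<A>) * M (k + 1) UNIV - M (k + 1) \<A> * (\<Sum>e\<in>F. M1 e (k + 1) UNIV)"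
    by (simp add: cov sum_subtractf sum_distrib_left sum_distrib_right)
  also have "\<dots> = 0" unfolding sum_M1 by simp
  finally have sum_cov: "(\<Sum>e\<in>F. cov e) = 0" .
  define N where "N = {e \<in> F. 0 < M1 e (k + 1) UNIV \<and> 0 < M0 e (k + 1) UNIV}"
  show ?case
  proof (cases "N = {}")
    case False
    have "cov e = 0" if "e \<in> F - N" for e
      using that nn(2,3)[of e "k + 1" \<A>] nn(2,3)[of e "k + 1" UNIV] le(2,3)[of e "k + 1" \<A>]
      unfolding N_def cov_def by (auto simp: not_less)
    then have "(\<Sum>e\<in>N. cov e) = 0"
      using sum_cov S by (subst sum.mono_neutral_left[of F]) (auto simp: N_def F_def)
    then obtain e where e: "e \<in> N" "0 \<le> cov e"
      using sum_strict_mono[of N cov "\<lambda>_. 0"] False S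
      by (auto simp: N_def F_def not_le) (metis (no_types, lifting) not_less order_less_irrefl)
    then have eF: "e \<in> F" unfolding N_def by simp
    have "S - insert e X - Y = F - {e}" "S - X - insert e Y = F - {e}" by (auto simp: F_def)
    moreover have "card (F - {e}) < card F" using S eF by (intro card_Diff1_less) (auto simp: F_def)
    ultimately have "card (S - insert e X - Y) < card (S - X - Y)" "card (S - X - insert e Y) < card (S - X - Y)"
      by (simp_all add: F_def)
    with less.hyps[of "insert e X" Y] less.hyps[of X "insert e Y"] XY eF
    have IH: "M1 e k \<A> * M1 e (k + 1) UNIV \<le> M1 e (k + 1) \<A> * M1 e k UNIV"
      "M0 e k \<A> * M0 e (k + 1) UNIV \<le> M0 e (k + 1) \<A> * M0 e k UNIV"
      unfolding defs by (auto simp: F_def)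
    have "(M1 e k \<A> + M0 e k \<A>) * (M1 e (k + 1) UNIV + M0 e (k + 1) UNIV)
        \<le> (M1 e (k + 1) \<A> + M0 e (k + 1) \<A>) * (M1 e k UNIV + M0 e k UNIV)"
      by (rule mixture_ratio_mono[OF IH single'[OF eF]]) (use e in \<open>auto simp: cov_def N_def\<close>)
    then show ?thesis
      using split[OF eF] by (simp add: M_def)
  next
    case True
    show ?thesis
    proof (cases "M k \<A> = 0")
      case True
      then show ?thesis using nn by (simp add: M_def)
    next
      case False
      then obtain Z where Z: "X \<subseteq> Z" "Z \<subseteq> S - Y" "card Z = k" "Z \<in> \<A>" "\<nu> Z \<noteq> 0"
        unfolding M_def level_mass_def by (auto elim: sum.not_neutral_contains_not_neutral)
      have Zpos: "0 < \<nu> Z" using Z nonneg[of Z] by (auto simp: less_le)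
      have "Z' \<in> \<A>" if Z': "X \<subseteq> Z'" "Z' \<subseteq> S - Y" "card Z' = k + 1" "\<nu> Z' \<noteq> 0" for Z'
      proof (rule ccontr)
        assume "Z' \<notin> \<A>"
        then obtain e where e: "e \<in> Z" "e \<notin> Z'" using up[of Z Z'] Z Z' by blast
        then have eF: "e \<in> F" using Z Z' by (auto simp: F_def)
        have Z'pos: "0 < \<nu> Z'" using Z' nonneg[of Z'] by (auto simp: less_le)
        have "0 < M0 e (k + 1) UNIV"
          unfolding M0_def by (rule level_mass_pos[where Z = Z']) (use Z' Z'pos e S nonneg in auto)
        moreover have "0 < M1 e k UNIV"
          unfolding M1_def by (rule level_mass_pos[where Z = Z]) (use Z Zpos e S nonneg in auto)
        moreover have "M1 e (k + 1) UNIV = 0"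
          using \<open>N = {}\<close> eF calculation(1) nn(2)[of e "k + 1" UNIV] unfolding N_def by (auto simp: less_le)
        ultimately show False using single'[OF eF] by (simp add: mult_le_0_iff)
      qed
      then have "M (k + 1) \<A> = M (k + 1) UNIV"
        unfolding M_def level_mass_def by (intro sum.mono_neutral_left) (use S in \<open>auto intro: finite_subset[of _ "Pow S"]\<close>)
      then show ?thesis
        using mult_left_mono[OF le(1)[of k \<A>] nn(1)[of "k + 1" UNIV]] by (simp add: M_def mult.commute)
    qed
  qed
qed

section \<open>Normalized matching for nonnegative weights\<close>

context urns
begin

definition fibre_weight :: "('a \<Rightarrow> 'b \<Rightarrow> real) \<Rightarrow> 'a set \<Rightarrow> 'b set \<Rightarrow> 'a set \<Rightarrow> real" where
  "fibre_weight w S J Z = (\<Sum>\<sigma>\<in>S \<rightarrow>\<^sub>E B.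
     of_bool (J \<subseteq> \<sigma> ` S \<and> {i \<in> S. \<sigma> i = top} = Z) * (\<Prod>i\<in>S. w i (\<sigma> i)))"

lemma sum_fibre_weight:
  assumes "finite L"
  shows "(\<Sum>Z\<in>L. fibre_weight w S J Z) = (\<Sum>\<sigma>\<in>S \<rightarrow>\<^sub>E B.
     of_bool (J \<subseteq> \<sigma> ` S \<and> {i \<in> S. \<sigma> i = top} \<in> L) * (\<Prod>i\<in>S. w i (\<sigma> i)))"
proof -
  have "(\<Sum>Z\<in>L. of_bool (J \<subseteq> \<sigma> ` S \<and> {i \<in> S. \<sigma> i = top} = Z) :: real)
      = of_bool (J \<subseteq> \<sigma> ` S \<and> {i \<in> S. \<sigma> i = top} \<in> L)" for \<sigma> :: "'a \<Rightarrow> 'b"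
    using assms by (simp add: of_bool_conj sum_distrib_left[symmetric] sum.delta')
  then show ?thesis
    unfolding fibre_weight_def
    by (subst sum.swap) (simp add: sum_distrib_right[symmetric])
qed

text \<open>Weights that force the balls of \<open>X\<close> into \<open>top\<close> and keep those of \<open>Y\<close> out of it. They are not
  normalized, which is harmless as all inequalities are homogeneous.\<close>

definition conditioned :: "'a set \<Rightarrow> 'a set \<Rightarrow> ('a \<Rightarrow> 'b \<Rightarrow> real) \<Rightarrow> 'a \<Rightarrow> 'b \<Rightarrow> real" where
  "conditioned X Y w i y = (if i \<in> X \<and> y \<noteq> top \<or> i \<in> Y \<and> y = top then 0 else w i y)"

lemma level_mass_fibre_weight:
  assumes "finite S" "X \<subseteq> S" "Y \<subseteq> S"
  shows "level_mass (fibre_weight w S J) S X Y k UNIV = weight (conditioned X Y w) S J (int k)"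
proof -
  have fin: "finite {Z. X \<subseteq> Z \<and> Z \<subseteq> S - Y \<and> card Z = k \<and> Z \<in> UNIV}"
    using assms by (auto intro: finite_subset[of _ "Pow S"])
  have "(\<Prod>i\<in>S. conditioned X Y w i (\<sigma> i))
      = of_bool (X \<subseteq> {i \<in> S. \<sigma> i = top} \<and> {i \<in> S. \<sigma> i = top} \<subseteq> S - Y) * (\<Prod>i\<in>S. w i (\<sigma> i))" for \<sigma>
  proof (cases "X \<subseteq> {i \<in> S. \<sigma> i = top} \<and> {i \<in> S. \<sigma> i = top} \<subseteq> S - Y")
    case True
    then show ?thesis by (auto simp: conditioned_def intro!: prod.cong)
  next
    case False
    then obtain i where "i \<in> S" "i \<in> X \<and> \<sigma> i \<noteq> top \<or> i \<in> Y \<and> \<sigma> i = top"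
      using assms by blast
    then have "i \<in> S" "conditioned X Y w i (\<sigma> i) = 0" by (auto simp: conditioned_def)
    then have "(\<Prod>i\<in>S. conditioned X Y w i (\<sigma> i)) = 0" using assms by (intro prod_zero) auto
    with False show ?thesis by auto
  qed
  then show ?thesis
    unfolding level_mass_def sum_fibre_weight[OF fin] weight_def
    by (intro sum.cong refl) auto
qed

text \<open>The one-element hypothesis of \<open>feder_mihail_levels\<close> is obtained by expanding by the bin of \<open>e\<close>. If \<open>e\<close>
  is in \<open>top\<close>, the level for the other balls drops by one; if it is in \<open>y\<close>, they
  no longer need to occupy \<open>y\<close>. The resulting terms are compared by the first interlacing condition.\<close>

lemma fibre_weight_normalized_matching:
  fixes w :: "'a \<Rightarrow> 'b \<Rightarrow> real"
  assumes S: "finite S" and J: "J \<subseteq> B - {top, null}"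
    and w: "\<And>i y. i \<in> S \<Longrightarrow> y \<in> B \<Longrightarrow> 0 \<le> w i y"
    and up: "\<And>Z Z'. Z \<in> \<A> \<Longrightarrow> Z \<subseteq> Z' \<Longrightarrow> Z' \<subseteq> S \<Longrightarrow> Z' \<in> \<A>"
  shows "level_mass (fibre_weight w S J) S {} {} k \<A> * level_mass (fibre_weight w S J) S {} {} (k + 1) UNIV
    \<le> level_mass (fibre_weight w S J) S {} {} (k + 1) \<A> * level_mass (fibre_weight w S J) S {} {} k UNIV"
proof (rule feder_mihail_levels[OF S])
  show "0 \<le> fibre_weight w S J Z" for Z
    unfolding fibre_weight_def by (intro sum_nonneg mult_nonneg_nonneg prod_nonneg) (auto intro: w)
  fix X Y e k assume XY: "X \<subseteq> S" "Y \<subseteq> S" "X \<inter> Y = {}" and e: "e \<in> S - X - Y"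
  define S' where "S' = S - {e}"
  have S': "finite S'" "e \<notin> S'" "S = insert e S'" using S e by (auto simp: S'_def)
  define v where "v = conditioned X Y w"
  let ?g = "weight v S'"
  have v: "0 \<le> v i y" if "i \<in> S" "y \<in> B" for i y using that w by (simp add: v_def conditioned_def)
  have topJ: "top \<notin> J" using J by auto
  have int: "interlaced v S' J" using S' J v by (intro interlaced_nonneg) auto
  have in_top: "level_mass (fibre_weight w S J) S (insert e X) Y k UNIV = w e top * ?g J (int k - 1)" for k
  proof -
    have same: "weight (conditioned (insert e X) Y w) S' J' k' = ?g J' k'" for J' k'
      using S' by (intro weight_cong) (auto simp: v_def conditioned_def)
    have "level_mass (fibre_weight w S J) S (insert e X) Y k UNIV
        = weight (conditioned (insert e X) Y w) S J (int k)"
      using XY e by (intro level_mass_fibre_weight S) auto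
    also have "\<dots> = w e top * ?g J (int k - 1)"
      using e by (simp add: S'(3) weight_insert[OF S'(1,2) topJ] same) (simp add: conditioned_def)
    finally show ?thesis .
  qed
  have not_top: "level_mass (fibre_weight w S J) S X (insert e Y) k UNIV
      = (\<Sum>y\<in>B - {top}. w e y * ?g (J - {y}) (int k))" for k
  proof -
    have same: "weight (conditioned X (insert e Y) w) S' J' k' = ?g J' k'" for J' k'
      using S' by (intro weight_cong) (auto simp: v_def conditioned_def)
    have "level_mass (fibre_weight w S J) S X (insert e Y) k UNIV
        = weight (conditioned X (insert e Y) w) S J (int k)"
      using XY e by (intro level_mass_fibre_weight S) auto
    also have "\<dots> = (\<Sum>y\<in>B - {top}. w e y * ?g (J - {y}) (int k))"
      using e by (simp add: S'(3) weight_insert[OF S'(1,2) topJ] same) (simp add: conditioned_def)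
    finally show ?thesis .
  qed
  have "(\<Sum>y\<in>B - {top}. w e y * (?g J (int k - 1) * ?g (J - {y}) (int k + 1)))
      \<le> (\<Sum>y\<in>B - {top}. w e y * (?g J (int k) * ?g (J - {y}) (int k)))"
    using e w by (intro sum_mono mult_left_mono interlaced_shift[OF int]) auto
  then have "w e top * (\<Sum>y\<in>B - {top}. w e y * (?g J (int k - 1) * ?g (J - {y}) (int k + 1)))
      \<le> w e top * (\<Sum>y\<in>B - {top}. w e y * (?g J (int k) * ?g (J - {y}) (int k)))"
    using e w top by (intro mult_left_mono) auto
  then show "level_mass (fibre_weight w S J) S (insert e X) Y k UNIV * level_mass (fibre_weight w S J) S X (insert e Y) (k + 1) UNIV
    \<le> level_mass (fibre_weight w S J) S (insert e X) Y (k + 1) UNIV * level_mass (fibre_weight w S J) S X (insert e Y) k UNIV"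
    unfolding in_top not_top by (simp add: sum_distrib_left mult_ac add_ac)
qed (use up in auto)

end

section \<open>Random functions with independent values\<close>

text \<open>The sum may range over functions into a set \<open>B\<close> larger than the set \<open>C\<close> of possible values; this leaves room
  for the bin \<open>null\<close>, which receives balls with probability zero.\<close>

lemma (in prob_space) prob_indep_pattern:
  fixes X :: "'i \<Rightarrow> 'a \<Rightarrow> 'b"
  assumes X: "indep_vars (\<lambda>_. count_space C) X I" and I: "finite I" "I \<noteq> {}"
    and B: "finite B" "C \<subseteq> B"
  shows "{\<omega> \<in> space M. R (restrict (\<lambda>i. X i \<omega>) I)} \<in> events"
    and "prob {\<omega> \<in> space M. R (restrict (\<lambda>i. X i \<omega>) I)}
      = (\<Sum>\<tau>\<in>I \<rightarrow>\<^sub>E B. of_bool (R \<tau>) * (\<Prod>i\<in>I. prob (X i -` {\<tau> i} \<inter> space M)))"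
proof -
  have rv: "X i \<in> measurable M (count_space C)" if "i \<in> I" for i
    using X that unfolding indep_vars_def by auto
  have val: "X i \<omega> \<in> C" if "i \<in> I" "\<omega> \<in> space M" for i \<omega>
    using measurable_space[OF rv[OF that(1)] that(2)] by simp
  define E where "E \<tau> = {\<omega> \<in> space M. \<forall>i\<in>I. X i \<omega> = \<tau> i}" for \<tau>
  have E: "E \<tau> = (\<Inter>i\<in>I. X i -` ({\<tau> i} \<inter> C) \<inter> space M)" for \<tau>
    using I(2) val by (auto simp: E_def)
  have point: "X i -` ({y} \<inter> C) \<inter> space M = X i -` {y} \<inter> space M" if "i \<in> I" for i y
    using val[OF that] by auto
  have E_sets: "E \<tau> \<in> events" for \<tau>
    unfolding E using I rv by (intro sets.finite_INT measurable_sets[of _ M "count_space C"]) auto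
  have E_prob: "prob (E \<tau>) = (\<Prod>i\<in>I. prob (X i -` {\<tau> i} \<inter> space M))" for \<tau>
  proof -
    have "prob (E \<tau>) = (\<Prod>i\<in>I. prob (X i -` ({\<tau> i} \<inter> C) \<inter> space M))"
      unfolding E by (rule indep_varsD_finite[OF X I(2,1)]) simp
    then show ?thesis by (simp only: point cong: prod.cong)
  qed
  let ?P = "{\<tau> \<in> I \<rightarrow>\<^sub>E B. R \<tau>}"
  have fin: "finite (I \<rightarrow>\<^sub>E B)" using I B by (intro finite_PiE) auto
  have union: "{\<omega> \<in> space M. R (restrict (\<lambda>i. X i \<omega>) I)} = (\<Union>\<tau>\<in>?P. E \<tau>)"
  proof (intro equalityI subsetI)
    fix \<omega> assume "\<omega> \<in> {\<omega> \<in> space M. R (restrict (\<lambda>i. X i \<omega>) I)}"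
    then have "restrict (\<lambda>i. X i \<omega>) I \<in> ?P" "\<omega> \<in> E (restrict (\<lambda>i. X i \<omega>) I)"
      using val B(2) by (auto simp: E_def)
    then show "\<omega> \<in> (\<Union>\<tau>\<in>?P. E \<tau>)" by blast
  next
    fix \<omega> assume "\<omega> \<in> (\<Union>\<tau>\<in>?P. E \<tau>)"
    then obtain \<tau> where \<tau>: "\<tau> \<in> I \<rightarrow>\<^sub>E B" "R \<tau>" "\<omega> \<in> E \<tau>" by blast
    then have "restrict (\<lambda>i. X i \<omega>) I = \<tau>"
      by (intro PiE_ext[of _ I "\<lambda>_. UNIV"]) (auto simp: E_def PiE_def)
    with \<tau> show "\<omega> \<in> {\<omega> \<in> space M. R (restrict (\<lambda>i. X i \<omega>) I)}" by (simp add: E_def)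
  qed
  show "{\<omega> \<in> space M. R (restrict (\<lambda>i. X i \<omega>) I)} \<in> events"
    unfolding union using fin E_sets by (intro sets.finite_UN) auto
  have "disjoint_family_on E ?P"
    unfolding disjoint_family_on_def
  proof (intro ballI impI)
    fix \<tau> \<tau>' assume \<tau>: "\<tau> \<in> ?P" "\<tau>' \<in> ?P" "\<tau> \<noteq> \<tau>'"
    then obtain i where "i \<in> I" "\<tau> i \<noteq> \<tau>' i" using PiE_ext[of \<tau> I "\<lambda>_. B" \<tau>'] by blast
    then show "E \<tau> \<inter> E \<tau>' = {}" by (auto simp: E_def)
  qed
  then have "prob (\<Union>\<tau>\<in>?P. E \<tau>) = (\<Sum>\<tau>\<in>?P. prob (E \<tau>))"
    using fin E_sets by (intro finite_measure_finite_Union) auto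
  also have "\<dots> = (\<Sum>\<tau>\<in>I \<rightarrow>\<^sub>E B. of_bool (R \<tau>) * prob (E \<tau>))"
    using fin by (simp add: sum.inter_filter of_bool_def if_distrib[of "\<lambda>x. x * _"] cong: if_cong)
  finally show "prob {\<omega> \<in> space M. R (restrict (\<lambda>i. X i \<omega>) I)}
      = (\<Sum>\<tau>\<in>I \<rightarrow>\<^sub>E B. of_bool (R \<tau>) * (\<Prod>i\<in>I. prob (X i -` {\<tau> i} \<inter> space M)))"
    unfolding union E_prob .
qed

lemma one_le_bin_load_iff: "1 \<le> bin_load m \<sigma> j \<omega> \<longleftrightarrow> j \<in> (\<lambda>i. \<sigma> i \<omega>) ` {1..m}"
  unfolding bin_load_def preimage_set_def by (auto simp: Suc_le_eq card_gt_0_iff)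

theorem theorem1p4:
  fixes M :: "'a measure" and \<sigma> :: "nat \<Rightarrow> 'a \<Rightarrow> nat" and m n d :: nat
  assumes "m \<ge> 1" and "n \<ge> 1"
    and "prob_space M"
    and "prob_space.indep_vars M (\<lambda>_. count_space {1..n}) \<sigma> {1..m}"
    and "d \<in> {0..n - 1}"
    and "measure M (occ_event M m \<sigma> d) > 0"
  shows "normalized_matching_property m (occ_law M m n \<sigma> d)"
proof -
  interpret prob_space M by fact
  \<comment> \<open>Bin 0, which no ball can reach, plays the role of \<open>null\<close>.\<close>
  interpret urns "{0..n}" n 0 using assms(2) by unfold_locales auto
  let ?Q = "occ_event M m \<sigma> d" and ?Z = "preimage_set m \<sigma> n" and ?N = "occ_law M m n \<sigma> d"
  define w where "w i y = prob (\<sigma> i -` {y} \<inter> space M)" for i y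
  define \<nu> where "\<nu> = fibre_weight w {1..m} {1..d}"
  have pattern: "{\<omega> \<in> space M. R (restrict (\<lambda>i. \<sigma> i \<omega>) {1..m})} \<in> events"
    "prob {\<omega> \<in> space M. R (restrict (\<lambda>i. \<sigma> i \<omega>) {1..m})}
      = (\<Sum>\<tau>\<in>{1..m} \<rightarrow>\<^sub>E {0..n}. of_bool (R \<tau>) * (\<Prod>i\<in>{1..m}. w i (\<tau> i)))" for R
    using prob_indep_pattern[OF assms(4) _ _ _ , of "{0..n}" R] assms(1) by (auto simp: w_def)
  have Z_restrict: "{i \<in> {1..m}. restrict (\<lambda>i. \<sigma> i \<omega>) {1..m} i = n} = ?Z \<omega>" for \<omega>
    by (auto simp: preimage_set_def)
  have Z_event: "?Z -` \<D> \<inter> space M \<in> events" for \<D>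
    using pattern(1)[of "\<lambda>\<tau>. {i \<in> {1..m}. \<tau> i = n} \<in> \<D>"]
    unfolding Z_restrict by (simp add: vimage_def Int_def conj_commute)
  have Q_restrict: "?Q = {\<omega> \<in> space M. {1..d} \<subseteq> restrict (\<lambda>i. \<sigma> i \<omega>) {1..m} ` {1..m}}"
    unfolding occ_event_def one_le_bin_load_iff by auto
  have Q_event: "?Q \<in> events" unfolding Q_restrict by (rule pattern(1))
  have QZ: "prob (?Q \<inter> (?Z -` \<D> \<inter> space M)) = (\<Sum>Z\<in>\<D>. \<nu> Z)" if "finite \<D>" for \<D>
  proof -
    have "?Q \<inter> (?Z -` \<D> \<inter> space M) = {\<omega> \<in> space M. {1..d} \<subseteq> restrict (\<lambda>i. \<sigma> i \<omega>) {1..m} ` {1..m}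
        \<and> {i \<in> {1..m}. restrict (\<lambda>i. \<sigma> i \<omega>) {1..m} i = n} \<in> \<D>}"
      unfolding Q_restrict Z_restrict by auto
    then show ?thesis
      unfolding \<nu>_def sum_fibre_weight[OF that] using pattern(2)
        [of "\<lambda>\<tau>. {1..d} \<subseteq> \<tau> ` {1..m} \<and> {i \<in> {1..m}. \<tau> i = n} \<in> \<D>"] by simp
  qed
  have Q0: "emeasure M ?Q \<noteq> 0" "emeasure M ?Q \<noteq> \<infinity>"
    using assms(6) by (auto simp: emeasure_eq_measure)
  have Z_measurable: "?Z \<in> measurable (uniform_measure M ?Q) (count_space (Pow {1..m}))"
    using Z_event by (auto simp: measurable_def preimage_set_def)
  have space: "space ?N = Pow {1..m}" and sets: "sets ?N = Pow (Pow {1..m})"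
    by (simp_all add: occ_law_def)
  have law: "measure ?N \<D> = (\<Sum>Z\<in>\<D>. \<nu> Z) / prob ?Q" if "\<D> \<subseteq> Pow {1..m}" for \<D>
  proof -
    have "finite \<D>" using that by (rule finite_subset) simp
    have "measure ?N \<D> = measure (uniform_measure M ?Q) (?Z -` \<D> \<inter> space M)"
      unfolding occ_law_def using that by (subst measure_distr[OF Z_measurable]) auto
    also have "\<dots> = prob (?Q \<inter> (?Z -` \<D> \<inter> space M)) / prob ?Q"
      by (intro measure_uniform_measure Q0 Z_event)
    finally show ?thesis using QZ[OF \<open>finite \<D>\<close>] by simp
  qed
  have level: "measure ?N {Z \<in> space ?N. Z \<in> \<A> \<and> card Z = k} = level_mass \<nu> {1..m} {} {} k \<A> / prob ?Q"
    "measure ?N {Z \<in> space ?N. card Z = k} = level_mass \<nu> {1..m} {} {} k UNIV / prob ?Q" for k \<A>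
  proof -
    show "measure ?N {Z \<in> space ?N. Z \<in> \<A> \<and> card Z = k} = level_mass \<nu> {1..m} {} {} k \<A> / prob ?Q" for \<A>
      unfolding level_mass_def space by (subst law) (auto intro!: arg_cong2[where f = "(/)"] sum.cong)
    from this[of UNIV] show "measure ?N {Z \<in> space ?N. card Z = k} = level_mass \<nu> {1..m} {} {} k UNIV / prob ?Q"
      by simp
  qed
  show ?thesis
    unfolding normalized_matching_property_def
  proof (intro conjI allI impI)
    show "prob_space ?N"
      unfolding occ_law_def using Q0
      by (intro prob_space.prob_space_distr[OF _ Z_measurable] prob_space_uniform_measure)
    show "sets ?N = Pow (Pow {1..m})" by (rule sets)
    fix k \<A>
    assume \<A>: "increasing_family m \<A>"
      and "0 < \<P>(Z in ?N. card Z = k)" "0 < \<P>(Z in ?N. card Z = k + 1)"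
    then have pos: "0 < level_mass \<nu> {1..m} {} {} k UNIV" "0 < level_mass \<nu> {1..m} {} {} (k + 1) UNIV"
      using assms(6) unfolding level by (simp_all add: zero_less_divide_iff)
    have "level_mass \<nu> {1..m} {} {} k \<A> * level_mass \<nu> {1..m} {} {} (k + 1) UNIV
        \<le> level_mass \<nu> {1..m} {} {} (k + 1) \<A> * level_mass \<nu> {1..m} {} {} k UNIV"
      unfolding \<nu>_def
    proof (rule fibre_weight_normalized_matching)
      show "{1..d} \<subseteq> {0..n} - {n, 0}" using assms(2,5) by auto
      show "Z' \<in> \<A>" if "Z \<in> \<A>" "Z \<subseteq> Z'" "Z' \<subseteq> {1..m}" for Z Z'
        using \<A> that unfolding increasing_family_def by blast
    qed (simp_all add: w_def)
    with pos assms(6) show "\<P>(Z in ?N. Z \<in> \<A> \<bar> card Z = k) \<le> \<P>(Z in ?N. Z \<in> \<A> \<bar> card Z = k + 1)"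
      unfolding cond_prob_def level by (simp add: divide_simps)
  qed
qed

end
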